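(* Let $k\ge1$, $m\ge3$ and $n\ge4$ be integers. Then \[ \gamma_{[k]R}(C_m\Box P_n) \le m (n-2)\left\lceil\frac{k+4}{5}\right\rceil + 2m\left\lceil \frac{k+3-\left\lceil\frac{k+4}{5}\right\rceil}{3} \right\rceil. \]
   Context: All graphs are finite and simple. For a vertex $v$ of a graph $G$, $N(v)$ denotes its open neighborhood and $N[v]=N(v)\cup\{v\}$ its closed neighborhood. For $f:V(G)\to\mathbb{N}_0$ and $S\subseteq V(G)$ write $f(S)=\sum_{u\in S}f(u)$. For a positive integer $k$, a $[k]$-Roman dominating function of $G$ is a function $f:V(G)\to\{0,1,\dots,k+1\}$ such that every vertex $v$ with $f(v)<k$ satisfies $f(N[v])\ge k+|AN(v)|$, where $AN(v)=\{u\in N(v): f(u)>0\}$. The $[k]$-Roman domination number $\gamma_{[k]R}(G)$ is the minimum of $f(V(G))$ over all $[k]$-Roman dominating functions $f$ of $G$. $C_m\Box P_n$ denotes the Cartesian product of the cycle $C_m$ ($m\ge3$) and the path $P_n$ on $n$ vertices: its vertices are pairs $(i,j)$ with $i\in\{0,\dots,m-1\}$, $j\in\{0,\dots,n-1\}$, and $(i,j)$ is adjacent to $(i',j')$ iff either $j=j'$ and $i-i'\equiv\pm1\pmod m$, or $i=i'$ and $|j-j'|=1$. *)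

theory Defs
  imports Complex_Main "HOL-Number_Theory.Cong" "Graph_Theory.Pair_Digraph"
begin

text \<open>
  A finite simple graph is a graph satisfying the locale predicate \<^term>\<open>pair_graph\<close>:
  every edge is represented by both of its orientations, and there are no loops.
\<close>

definition nbhd :: "'a pair_pre_digraph \<Rightarrow> 'a \<Rightarrow> 'a set" where
  "nbhd G v = {u. (v, u) \<in> parcs G}"

definition closed_nbhd :: "'a pair_pre_digraph \<Rightarrow> 'a \<Rightarrow> 'a set" where
  "closed_nbhd G v = insert v (nbhd G v)"

definition active_nbhd :: "'a pair_pre_digraph \<Rightarrow> ('a \<Rightarrow> nat) \<Rightarrow> 'a \<Rightarrow> 'a set" where
  "active_nbhd G f v = {u \<in> nbhd G v. f u > 0}"

text \<open>Values of \<open>f\<close> outside the vertex set are irrelevant.\<close>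

definition roman_dominating :: "nat \<Rightarrow> 'a pair_pre_digraph \<Rightarrow> ('a \<Rightarrow> nat) \<Rightarrow> bool" where
  "roman_dominating k G f \<longleftrightarrow>
     (\<forall>v \<in> pverts G. f v \<le> k + 1) \<and>
     (\<forall>v \<in> pverts G. f v < k \<longrightarrow> sum f (closed_nbhd G v) \<ge> k + card (active_nbhd G f v))"

definition roman_domination_number :: "nat \<Rightarrow> 'a pair_pre_digraph \<Rightarrow> nat" where
  "roman_domination_number k G = (LEAST w. \<exists>f. roman_dominating k G f \<and> sum f (pverts G) = w)"

text \<open>
  The \<^const>\<open>Least\<close> above is a genuine minimum: the constant function \<open>k + 1\<close> is
  always admissible.
\<close>

lemma roman_dominating_const: "roman_dominating k G (\<lambda>_. k + 1)"
  by (simp add: roman_dominating_def)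

lemma roman_domination_number_attained:
  "\<exists>f. roman_dominating k G f \<and> sum f (pverts G) = roman_domination_number k G"
  unfolding roman_domination_number_def
  by (rule LeastI_ex) (use roman_dominating_const in blast)

lemma roman_domination_number_le:
  "roman_dominating k G f \<Longrightarrow> roman_domination_number k G \<le> sum f (pverts G)"
  unfolding roman_domination_number_def by (rule Least_le) blast

text \<open>For \<open>m < 3\<close> the following is not the graph one would call a cycle.\<close>

definition cycle_graph :: "nat \<Rightarrow> nat pair_pre_digraph" where
  "cycle_graph m = \<lparr> pverts = {..<m},
     parcs = {(i, i'). i < m \<and> i' < m \<and>
       ([int i - int i' = 1] (mod int m) \<or> [int i - int i' = - 1] (mod int m))} \<rparr>"

definition path_graph :: "nat \<Rightarrow> nat pair_pre_digraph" where
  "path_graph n = \<lparr> pverts = {..<n},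
     parcs = {(j, j'). j < n \<and> j' < n \<and> \<bar>int j - int j'\<bar> = 1} \<rparr>"

definition cartesian_product ::
    "'a pair_pre_digraph \<Rightarrow> 'b pair_pre_digraph \<Rightarrow> ('a \<times> 'b) pair_pre_digraph"
    (infixl "\<box>" 70) where
  "G \<box> H = \<lparr> pverts = pverts G \<times> pverts H,
     parcs = {((a, b), (a', b')).
       (b = b' \<and> b \<in> pverts H \<and> (a, a') \<in> parcs G) \<or>
       (a = a' \<and> a \<in> pverts G \<and> (b, b') \<in> parcs H)} \<rparr>"

lemma pverts_cycle_box_path: "pverts (cycle_graph m \<box> path_graph n) = {..<m} \<times> {..<n}"
  by (simp add: cartesian_product_def cycle_graph_def path_graph_def)

lemma parcs_cycle_box_path:
  "((i, j), (i', j')) \<in> parcs (cycle_graph m \<box> path_graph n) \<longleftrightarrow>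
     i < m \<and> i' < m \<and> j < n \<and> j' < n \<and>
     (j = j' \<and> ([int i - int i' = 1] (mod int m) \<or> [int i - int i' = - 1] (mod int m)) \<or>
      i = i' \<and> \<bar>int j - int j'\<bar> = 1)"
  by (auto simp: cartesian_product_def cycle_graph_def path_graph_def)

lemma pair_graph_cycle:
  assumes "m \<ge> 3"
  shows "pair_graph (cycle_graph m)"
proof
  show "finite (parcs (cycle_graph m))"
    by (rule finite_subset[of _ "{..<m} \<times> {..<m}"]) (auto simp: cycle_graph_def)
  have cong_swap: "[x - y = c] (mod M) \<Longrightarrow> [y - x = - c] (mod M)" for x y c M :: int
    using cong_minus_minus_iff[of "x - y" c M] by simp
  show "symmetric (cycle_graph m)"
    using cong_swap by (fastforce simp: symmetric_def sym_def cycle_graph_def)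
  show "fst e \<noteq> snd e" if "e \<in> parcs (cycle_graph m)" for e
    using that assms by (auto simp: cycle_graph_def cong_iff_dvd_diff zdvd_not_zless)
qed (auto simp: cycle_graph_def)

lemma pair_graph_path: "pair_graph (path_graph n)"
proof
  show "finite (parcs (path_graph n))"
    by (rule finite_subset[of _ "{..<n} \<times> {..<n}"]) (auto simp: path_graph_def)
qed (auto simp: path_graph_def symmetric_def sym_def)

lemma pair_graph_cartesian_product:
  assumes "pair_graph G" "pair_graph H"
  shows "pair_graph (G \<box> H)"
proof -
  interpret G: pair_graph G by fact
  interpret H: pair_graph H by fact
  have arcs: "a \<in> pverts G" "a' \<in> pverts G" "a \<noteq> a'" "(a', a) \<in> parcs G"
    if "(a, a') \<in> parcs G" for a a'
    using that G.arc_fst_in_verts G.arc_snd_in_verts G.pair_no_loops G.pair_sym_arcs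
    by (fastforce simp: symmetric_def dest: symD)+
  have arcs': "b \<in> pverts H" "b' \<in> pverts H" "b \<noteq> b'" "(b', b) \<in> parcs H"
    if "(b, b') \<in> parcs H" for b b'
    using that H.arc_fst_in_verts H.arc_snd_in_verts H.pair_no_loops H.pair_sym_arcs
    by (fastforce simp: symmetric_def dest: symD)+
  show ?thesis
  proof
    show "finite (pverts (G \<box> H))"
      by (simp add: cartesian_product_def)
    have "parcs (G \<box> H) \<subseteq> (pverts G \<times> pverts H) \<times> (pverts G \<times> pverts H)"
      by (auto simp: cartesian_product_def dest: arcs arcs')
    then show "finite (parcs (G \<box> H))"
      by (rule finite_subset) simp
  qed (auto simp: cartesian_product_def symmetric_def sym_def dest: arcs arcs')
qed

end

theory Submission
  imports Defs
begin

text \<open>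
  Give every vertex of the \<open>n - 2\<close> inner cycles the value \<open>a = \<lceil>(k + 4) / 5\<rceil>\<close> and every vertex of
  the two outer cycles the value \<open>b = \<lceil>(k + 3 - a) / 3\<rceil>\<close>. All values are positive, so the condition
  at a vertex of degree \<open>d\<close> reads \<open>f(N[v]) \<ge> k + d\<close>. It amounts to \<open>3b + a \<ge> k + 3\<close> on an outer
  cycle, to \<open>4a + b \<ge> k + 4\<close> on an inner cycle next to an outer one, and to \<open>5a \<ge> k + 4\<close> on the
  remaining cycles.
\<close>

lemma nbhd_cartesian_product:
  assumes "x \<in> pverts G" "y \<in> pverts H"
  shows "nbhd (G \<box> H) (x, y) = nbhd G x \<times> {y} \<union> {x} \<times> nbhd H y"
  using assms by (auto simp: nbhd_def cartesian_product_def)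

lemma nbhd_path_graph:
  assumes "j < n"
  shows "nbhd (path_graph n) j
    = (if 0 < j then {j - 1} else {}) \<union> (if Suc j < n then {Suc j} else {})"
  using assms by (auto simp: nbhd_def path_graph_def)

lemma nbhd_cycle_graph:
  assumes "i < m"
  shows "nbhd (cycle_graph m) i
    = {if i = 0 then m - 1 else i - 1, if Suc i = m then 0 else Suc i}"
proof -
  \<comment> \<open>With \<open>d = c + M * q\<close> the bounds on \<open>d\<close> leave only
    \<open>q\<close> in {-1, 0, 1}, and \<open>q = c\<close> would push \<open>d\<close> out of
    range. The case \<open>q = - c\<close> is the wrap-around edge of the cycle.\<close>
  have *: "[d = c] (mod M) \<longleftrightarrow> d = c \<or> d = c - c * M"
    if "- M < d" "d < M" "c = 1 \<or> c = -1" for c d M :: int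
  proof
    assume "[d = c] (mod M)"
    then obtain q where q: "d = c + M * q"
      by (metis cong_iff_lin cong_sym)
    have M: "M > 0" using that by linarith
    have "M * q < M * 2" "M * (-2) < M * q"
      using that q M by linarith+
    then have "q < 2" "-2 < q"
      using M mult_less_cancel_left_pos by blast+
    then have "q = 0 \<or> q = 1 \<or> q = -1" by linarith
    then show "d = c \<or> d = c - c * M"
      using that q by auto
  qed (auto simp: cong_iff_dvd_diff)
  show ?thesis
    using assms by (auto simp: nbhd_def cycle_graph_def *)
qed

lemma card_nbhd_cycle_graph:
  assumes "m \<ge> 3" "i < m"
  shows "card (nbhd (cycle_graph m) i) = 2"
  using assms by (auto simp: nbhd_cycle_graph)

text \<open>Reduces domination to the path for weights constant on each cycle: a vertex and its two
  cycle neighbours contribute \<open>3 * g j\<close>, and positivity makes every neighbour active,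
  so the active count is the degree.\<close>

lemma roman_dominating_cycle_box_path:
  fixes g :: "nat \<Rightarrow> nat"
  assumes "m \<ge> 3"
    and pos: "\<And>j. j < n \<Longrightarrow> 0 < g j" and le: "\<And>j. j < n \<Longrightarrow> g j \<le> k + 1"
    and dom: "\<And>j. j < n \<Longrightarrow>
      k + 2 + card (nbhd (path_graph n) j) \<le> 3 * g j + sum g (nbhd (path_graph n) j)"
  shows "roman_dominating k (cycle_graph m \<box> path_graph n) (g \<circ> snd)"
proof -
  have "k + card (active_nbhd (cycle_graph m \<box> path_graph n) (g \<circ> snd) (i, j))
      \<le> sum (g \<circ> snd) (closed_nbhd (cycle_graph m \<box> path_graph n) (i, j))"
    if ij: "i < m" "j < n" for i j
  proof -
    let ?C = "nbhd (cycle_graph m) i" and ?P = "nbhd (path_graph n) j"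
    let ?N = "nbhd (cycle_graph m \<box> path_graph n) (i, j)"
    have N: "?N = ?C \<times> {j} \<union> {i} \<times> ?P"
      using ij by (intro nbhd_cartesian_product) (auto simp: cycle_graph_def path_graph_def)
    have fin: "finite ?C" "finite ?P"
      using ij by (auto simp: nbhd_cycle_graph nbhd_path_graph)
    have irr: "i \<notin> ?C" "j \<notin> ?P"
      using ij \<open>m \<ge> 3\<close> by (auto simp: nbhd_cycle_graph nbhd_path_graph)
    have disj: "(?C \<times> {j}) \<inter> ({i} \<times> ?P) = {}"
      using irr by auto
    have C: "card ?C = 2"
      using \<open>m \<ge> 3\<close> ij(1) by (rule card_nbhd_cycle_graph)
    have "sum (g \<circ> snd) (?C \<times> {j}) = 2 * g j"
      using C by (simp add: sum.cartesian_product' comp_def)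
    moreover have "sum (g \<circ> snd) ({i} \<times> ?P) = sum g ?P"
      by (simp add: sum.cartesian_product' comp_def)
    ultimately have "sum (g \<circ> snd) ?N = 2 * g j + sum g ?P"
      using fin disj by (simp add: N sum.union_disjoint del: comp_apply)
    moreover have "finite ?N" "(i, j) \<notin> ?N"
      using fin irr by (auto simp: N)
    ultimately have "sum (g \<circ> snd) (closed_nbhd (cycle_graph m \<box> path_graph n) (i, j))
        = 3 * g j + sum g ?P"
      by (simp add: closed_nbhd_def)
    moreover have "card ?N = 2 + card ?P"
      using fin disj C by (simp add: N card_Un_disjoint card_cartesian_product)
    moreover have "active_nbhd (cycle_graph m \<box> path_graph n) (g \<circ> snd) (i, j) = ?N"
      using pos ij by (auto simp: active_nbhd_def nbhd_def parcs_cycle_box_path)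
    ultimately show ?thesis
      using dom[OF \<open>j < n\<close>] by simp
  qed
  then show ?thesis
    using le by (auto simp: roman_dominating_def pverts_cycle_box_path)
qed

theorem theorem7:
  fixes k m n :: nat
  assumes "k \<ge> 1" and "m \<ge> 3" and "n \<ge> 4"
  shows "int (roman_domination_number k (cycle_graph m \<box> path_graph n))
    \<le> int m * (int n - 2) * \<lceil>(real k + 4) / 5\<rceil>
      + 2 * int m * \<lceil>(real k + 3 - real_of_int \<lceil>(real k + 4) / 5\<rceil>) / 3\<rceil>"
proof -
  \<comment> \<open>The two ceilings, written as \<lceil>x / d\<rceil> = (x + d - 1) div d. The
    truncated subtraction is exact since \<open>a \<le> k + 1\<close>.\<close>
  define a b where "a = (k + 8) div 5" and "b = (k + 5 - a) div 3"
  \<comment> \<open>For \<open>k + 4 \<le> 4 * a + b\<close>: three times the right side is 11a +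
    (3b + a), at least 11(k + 4)/5 + k + 3 = (16k + 59)/5, and this is at least 3(k + 4) exactly
    when \<open>k \<ge> 1\<close>.\<close>
  have ab: "0 < a" "0 < b" "a \<le> k + 1" "b \<le> k + 1"
    "k + 4 \<le> 5 * a" "5 * a \<le> k + 8" "k + 4 \<le> 4 * a + b" "k + 3 \<le> 3 * b + a" "3 * b + a \<le> k + 5"
    using \<open>k \<ge> 1\<close> unfolding a_def b_def by linarith+
  have real_ab: "real k + 4 \<le> 5 * real a" "5 * real a \<le> real k + 8"
    "real k + 3 \<le> 3 * real b + real a" "3 * real b + real a \<le> real k + 5"
    using ab by simp_all
  have ceil_a: "\<lceil>(real k + 4) / 5\<rceil> = int a"
    by (rule ceiling_unique) (use real_ab in simp_all)
  have ceil_b: "\<lceil>(real k + 3 - real a) / 3\<rceil> = int b"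
    by (rule ceiling_unique) (use real_ab in simp_all)
  define g where "g j = (if j = 0 \<or> j = n - 1 then b else a)" for j
  have "roman_dominating k (cycle_graph m \<box> path_graph n) (g \<circ> snd)"
    using \<open>m \<ge> 3\<close>
  proof (rule roman_dominating_cycle_box_path)
    \<comment> \<open>As \<open>n \<ge> 4\<close>, no inner position is next to both ends and the
      ends are not adjacent, so only the three inequalities in \<open>ab\<close> with lower bounds
      \<open>k + 3\<close> or \<open>k + 4\<close> on the closed sums occur.\<close>
    fix j assume "j < n"
    then show "k + 2 + card (nbhd (path_graph n) j) \<le> 3 * g j + sum g (nbhd (path_graph n) j)"
      using ab \<open>n \<ge> 4\<close> by (auto simp: nbhd_path_graph g_def)
  qed (use ab in \<open>auto simp: g_def\<close>)
  then have "roman_domination_number k (cycle_graph m \<box> path_graph n)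
      \<le> sum (g \<circ> snd) ({..<m} \<times> {..<n})"
    by (metis roman_domination_number_le pverts_cycle_box_path)
  also have "\<dots> = m * sum g {..<n}"
    by (simp add: sum.cartesian_product' comp_def)
  also have "sum g {..<n} = (n - 2) * a + 2 * b"
  proof -
    have "{..<n} = insert 0 (insert (n - 1) {1..<n - 1})"
      using \<open>n \<ge> 4\<close> by auto
    moreover have "sum g {1..<n - 1} = (n - 2) * a"
      by (simp add: g_def numeral_2_eq_2)
    ultimately show ?thesis
      using \<open>n \<ge> 4\<close> by (simp add: g_def)
  qed
  finally have "int (roman_domination_number k (cycle_graph m \<box> path_graph n))
      \<le> int (m * ((n - 2) * a + 2 * b))"
    by (rule of_nat_mono)
  \<comment> \<open>The natural number \<open>n - 2\<close> is not truncated because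
    \<open>n \<ge> 4\<close>.\<close>
  also have "\<dots> = int m * (int n - 2) * int a + 2 * int m * int b"
    using \<open>n \<ge> 4\<close> by (simp add: of_nat_diff) (simp add: algebra_simps)
  finally show ?thesis
    by (simp add: ceil_a ceil_b)
qed

end
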